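(* For every positive integer $k$ and every nonnegative integer $n$, $$\det\left(q^{\binom{i-j}{2}}\begin{bmatrix} i+j+k\\ i-j+1\end{bmatrix}\right)_{i,j=0}^{n-1}=\det\left(q^{\binom{i-j+1}{2}}\begin{bmatrix} i+j+k\\ i-j+1\end{bmatrix}\right)_{i,j=0}^{n-1}=C_n^{(k)}(q)=\frac{[k]}{[2n+k]}\begin{bmatrix}2n+k\\ n\end{bmatrix}.$$
   Context: $q$ is an indeterminate. $[a]=\frac{1-q^a}{1-q}$, $(q;q)_a=(1-q)(1-q^2)\cdots(1-q^a)$, and for integers $a\ge0$, $b$ the Gaussian binomial coefficient is $\begin{bmatrix}a\\ b\end{bmatrix}=\frac{(q;q)_a}{(q;q)_b(q;q)_{a-b}}$ for $0\le b\le a$ and $0$ otherwise. For any integer $a$, $\binom{a}{2}=a(a-1)/2$. Determinants of $0\times0$ matrices equal $1$. *)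

theory Defs
  imports
    "HOL-Computational_Algebra.Normalized_Fraction"
    "Jordan_Normal_Form.Determinant"
begin

text \<open>
  The q-notions are defined for an element \<^term>\<open>q\<close> of an arbitrary field; they have their usual
  meaning only if \<^term>\<open>q\<close> is not a root of unity, because of the divisions involved. For the
  indeterminate below no denominator vanishes.
\<close>

definition q_number :: "'a::field \<Rightarrow> nat \<Rightarrow> 'a" where
  "q_number q a = (1 - q ^ a) / (1 - q)"

definition q_factorial :: "'a::field \<Rightarrow> nat \<Rightarrow> 'a" where
  "q_factorial q a = (\<Prod>m = 1..a. 1 - q ^ m)"

definition q_binomial :: "'a::field \<Rightarrow> nat \<Rightarrow> int \<Rightarrow> 'a" where
  "q_binomial q a b =
     (if 0 \<le> b \<and> b \<le> int a
      then q_factorial q a / (q_factorial q (nat b) * q_factorial q (a - nat b))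
      else 0)"

definition binom2 :: "int \<Rightarrow> int" where
  "binom2 a = a * (a - 1) div 2"

definition q_catalan :: "'a::field \<Rightarrow> nat \<Rightarrow> nat \<Rightarrow> 'a" where
  "q_catalan q k n =
     q_number q k / q_number q (2 * n + k) * q_binomial q (2 * n + k) (int n)"

text \<open>The indeterminate, as an element of the field of rational functions over the rationals.\<close>

definition indet :: "rat poly fract" where
  "indet = to_fract [:0, 1:]"

end

theory Submission
  imports Defs
begin

text \<open>
  Both matrices are lower Hessenberg. If \<open>w\<close> is a sequence with \<open>w 0 = 1\<close> annihilated by every row
  of such an infinite matrix, then replacing the first column of the \<open>n\<close>-th leading principal
  submatrix by its combination with coefficients \<open>w 0, \<dots>, w (n - 1)\<close> leaves the determinant
  unchanged and makes this column vanish except for its last entry, so the determinant is a product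
  of negated superdiagonal entries times \<open>w n\<close>. For both matrices at hand the requirement that
  \<open>w j\<close> be the \<open>j\<close>-th q-Catalan number, suitably rescaled, amounts to the alternating sum
  \<open>\<Sum>\<^sub>j (-1)\<^sup>j q\<^bsup>binom (n - j) 2\<^esup> [n + j + k - 1, n - j] C\<^sub>j = 0\<close> for \<open>n > 0\<close>, which telescopes.
\<close>

section \<open>Determinants of Hessenberg matrices\<close>

lemma det_hessenberg:
  fixes f :: "nat \<Rightarrow> nat \<Rightarrow> 'a::idom" and w :: "nat \<Rightarrow> 'a"
  assumes zero: "\<And>i j. Suc i < j \<Longrightarrow> f i j = 0"
    and w0: "w 0 = 1"
    and ker: "\<And>i. (\<Sum>j\<le>Suc i. f i j * w j) = 0"
  shows "det (mat n n (\<lambda>(i, j). f i j)) = (\<Prod>i<n. - f i (Suc i)) * w n"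
proof (cases n)
  case 0
  then show ?thesis by (simp add: w0)
next
  case (Suc m)
  define A where "A = mat n n (\<lambda>(i, j). f i j)"
  define L where "L = mat n n (\<lambda>(i, j). if j = 0 then w i else if i = j then 1 else 0)"
  \<comment> \<open>The relation for row \<open>m\<close> reaches one column past the matrix, so
    truncating it to \<open>n\<close> terms leaves the defect \<open>- f m n * w n\<close> as the
    only possibly nonzero entry of column 0.\<close>
  define B where "B = mat n n (\<lambda>(i, j). if j = 0 then (if i = m then - f m n * w n else 0) else f i j)"
  have A: "A \<in> carrier_mat n n" and L: "L \<in> carrier_mat n n" and B: "B \<in> carrier_mat n n"
    by (simp_all add: A_def L_def B_def)
  have "det L = prod_list (diag_mat L)"
    by (rule det_lower_triangular[OF _ L]) (auto simp: L_def)
  also have "diag_mat L = replicate n 1"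
    by (rule nth_equalityI) (auto simp: diag_mat_def L_def w0)
  finally have detL: "det L = 1" by simp
  have AL: "A * L = B"
  proof (rule eq_matI)
    fix i j assume "i < dim_row B" "j < dim_col B"
    then have i: "i < n" and j: "j < n" by (auto simp: B_def)
    have AL_ij: "(A * L) $$ (i, j)
        = (\<Sum>l<n. f i l * (if j = 0 then w l else if l = j then 1 else 0))"
      using i j by (simp add: A_def L_def scalar_prod_def atLeast0LessThan)
    show "(A * L) $$ (i, j) = B $$ (i, j)"
    proof (cases "j = 0")
      case False
      then have "(A * L) $$ (i, j) = (\<Sum>l<n. if l = j then f i l else 0)"
        unfolding AL_ij by (intro sum.cong) auto
      then show ?thesis using i j False by (simp add: B_def)
    next
      case True
      then have *: "(A * L) $$ (i, j) = (\<Sum>l<n. f i l * w l)" unfolding AL_ij by simp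
      show ?thesis
      proof (cases "i = m")
        case True
        have "(\<Sum>l<n. f i l * w l) + f m n * w n = 0"
          using ker[of m] Suc True by (simp add: lessThan_Suc_atMost)
        then show ?thesis
          using * i j True \<open>j = 0\<close> by (simp add: B_def eq_neg_iff_add_eq_0)
      next
        case False
        then have "(\<Sum>l<n. f i l * w l) = (\<Sum>l\<le>Suc i. f i l * w l)"
          using i Suc by (intro sum.mono_neutral_right) (auto simp: zero)
        then show ?thesis using * i j False \<open>j = 0\<close> ker[of i] by (simp add: B_def)
      qed
    qed
  qed (auto simp: A_def B_def L_def)
  \<comment> \<open>Deleting the last row and first column moves the superdiagonal of
    \<open>f\<close> onto the diagonal; what lies above it vanishes by the Hessenberg shape.\<close>
  define M where "M = mat_delete B m 0"
  have M: "M \<in> carrier_mat m m"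
    using B Suc by (simp add: M_def mat_delete_def B_def)
  have M_ij: "M $$ (i, j) = f i (Suc j)" if "i < m" "j < m" for i j
    using that Suc by (simp add: M_def mat_delete_def B_def)
  have "det M = prod_list (diag_mat M)"
    by (rule det_lower_triangular[OF _ M]) (auto simp: M_ij zero)
  then have detM: "det M = (\<Prod>i<m. f i (Suc i))"
    using M by (simp add: prod_list_diag_prod atLeast0LessThan M_ij)
  have "det A = det A * det L" by (simp add: detL)
  also have "\<dots> = det B" using det_mult[OF A L] AL by simp
  also have "\<dots> = (\<Sum>i<n. B $$ (i, 0) * cofactor B i 0)"
    by (rule laplace_expansion_column[OF B]) (simp add: Suc)
  also have "\<dots> = (\<Sum>i<n. if i = m then - f m n * w n * cofactor B m 0 else 0)"
    by (intro sum.cong) (auto simp: B_def Suc)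
  also have "\<dots> = - f m n * w n * ((- 1) ^ m * (\<Prod>i<m. f i (Suc i)))"
    by (simp add: Suc cofactor_def detM flip: M_def)
  also have "\<dots> = (\<Prod>i<n. - f i (Suc i)) * w n"
    by (simp add: Suc prod_uminus)
  finally show ?thesis by (simp add: A_def)
qed

section \<open>The alternating sum\<close>

lemma q_factorial_0 [simp]: "q_factorial q 0 = 1"
  by (simp add: q_factorial_def)

lemma q_factorial_Suc: "q_factorial q (Suc a) = q_factorial q a * (1 - q ^ Suc a)"
  by (simp add: q_factorial_def)

context
  fixes q :: "'a::field"
  assumes not_root_of_unity: "\<And>m. 0 < m \<Longrightarrow> q ^ m \<noteq> 1"
begin

lemma q_factorial_nonzero: "q_factorial q a \<noteq> 0"
  using not_root_of_unity by (fastforce simp: q_factorial_def)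

lemma one_minus_q_power_nonzero: "0 < m \<Longrightarrow> 1 - q ^ m \<noteq> 0"
  using not_root_of_unity[of m] by auto

text \<open>The summand of the alternating sum, stripped of its sign-free constant
  \<open>1 - q ^ k\<close>: the factor \<open>q_factorial q (2 * j + k - 1)\<close> of the q-Catalan
  number has cancelled against the q-binomial.\<close>

definition catalan_term :: "nat \<Rightarrow> nat \<Rightarrow> nat \<Rightarrow> 'a" where
  "catalan_term i k j = (- 1) ^ j * q ^ (Suc i - j choose 2) * q_factorial q (i + j + k)
     / (q_factorial q (Suc i - j) * q_factorial q j * q_factorial q (j + k))"

text \<open>The ratio of consecutive summands with denominators cleared; \<open>q ^ (i - j)\<close>
  is the quotient of the two powers of \<open>q\<close>, as shown by the recursion for
  \<open>Suc d choose 2\<close>.\<close>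

lemma catalan_term_Suc:
  assumes "j \<le> i"
  shows "q ^ (i - j) * catalan_term i k (Suc j) * (1 - q ^ Suc j) * (1 - q ^ (Suc j + k))
       = - catalan_term i k j * (1 - q ^ (Suc i - j)) * (1 - q ^ (Suc i + j + k))"
proof -
  obtain d where d: "i = j + d" using assms le_Suc_ex by blast
  note nz = q_factorial_nonzero one_minus_q_power_nonzero
  have 1: "Suc i - j = Suc d" "i - j = d" "Suc i - Suc j = d"
    using d by auto
  have 2: "q_factorial q (i + Suc j + k) = q_factorial q (i + j + k) * (1 - q ^ (Suc i + j + k))"
    using q_factorial_Suc[of q "i + j + k"] by simp
  have 3: "q_factorial q (Suc j + k) = q_factorial q (j + k) * (1 - q ^ (Suc j + k))"
    using q_factorial_Suc[of q "j + k"] by simp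
  have 4: "Suc d choose 2 = d + (d choose 2)"
    by (simp add: numeral_2_eq_2)
  show ?thesis
    unfolding catalan_term_def 1 2 3 4 q_factorial_Suc power_add[of q d]
    using nz(1)[of d] nz(1)[of j] nz(1)[of "j + k"] nz(2)[of "Suc j"] nz(2)[of "Suc j + k"]
      nz(2)[of "Suc d"]
    by (simp add: divide_simps power_Suc[of "- 1"] del: power_Suc add_Suc)
qed

text \<open>The telescoping step: each partial sum is a multiple of the next summand, by induction
  with the ratio from \<open>catalan_term_Suc\<close>.\<close>

lemma catalan_term_partial_sum:
  assumes "m \<le> Suc i"
  shows "(1 - q ^ Suc i) * (1 - q ^ (Suc i + k)) * (\<Sum>j<m. catalan_term i k j)
       = - (q ^ (Suc i - m) * catalan_term i k m * (1 - q ^ m) * (1 - q ^ (m + k)))"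
  using assms
proof (induction m)
  case 0
  then show ?case by simp
next
  case (Suc m)
  obtain d where i: "i = m + d" using Suc.prems le_Suc_ex by auto
  have "(1 - q ^ Suc i) * (1 - q ^ (Suc i + k)) * (\<Sum>j<Suc m. catalan_term i k j)
      = catalan_term i k m * ((1 - q ^ Suc i) * (1 - q ^ (Suc i + k))
          - q ^ (Suc i - m) * (1 - q ^ m) * (1 - q ^ (m + k)))"
    using Suc by (simp add: algebra_simps)
  \<comment> \<open>With \<open>A\<close>, \<open>M\<close>, \<open>K\<close> for the powers of
    \<open>q\<close> with exponents \<open>Suc i\<close>, \<open>m\<close>, \<open>k\<close>, both
    sides expand to \<open>1 - A / M - A * M * K + A * A * K\<close>.\<close>
  also have "(1 - q ^ Suc i) * (1 - q ^ (Suc i + k)) - q ^ (Suc i - m) * (1 - q ^ m) * (1 - q ^ (m + k))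
      = (1 - q ^ (Suc i - m)) * (1 - q ^ (Suc i + m + k))"
    by (simp add: i power_add algebra_simps)
  also have "catalan_term i k m * \<dots>
      = - (q ^ (i - m) * catalan_term i k (Suc m) * (1 - q ^ Suc m) * (1 - q ^ (Suc m + k)))"
    using Suc.prems by (subst catalan_term_Suc) (simp_all add: mult.assoc)
  finally show ?case by simp
qed

lemma catalan_term_sum: "(\<Sum>j\<le>Suc i. catalan_term i k j) = 0"
proof -
  have "(1 - q ^ Suc i) * (1 - q ^ (Suc i + k)) * (\<Sum>j\<le>Suc i. catalan_term i k j)
      = (1 - q ^ Suc i) * (1 - q ^ (Suc i + k)) * (\<Sum>j<Suc i. catalan_term i k j)
        + (1 - q ^ Suc i) * (1 - q ^ (Suc i + k)) * catalan_term i k (Suc i)"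
    by (simp only: lessThan_Suc_atMost[symmetric] sum.lessThan_Suc[of _ "Suc i"] distrib_left)
  also have "\<dots> = 0"
    \<comment> \<open>At \<open>m = Suc i\<close> the power of \<open>q\<close> is 1, and the
      partial sum cancels the last summand exactly.\<close>
    by (subst catalan_term_partial_sum) (simp_all add: mult_ac)
  finally show ?thesis
    using one_minus_q_power_nonzero[of "Suc i"] one_minus_q_power_nonzero[of "Suc i + k"] by simp
qed

text \<open>\<open>[2n+k]\<close> cancels the top factor of the q-factorial of
  \<open>2 * n + k\<close>; positivity of \<open>k\<close> keeps the subtraction of 1 from
  truncating.\<close>

lemma q_catalan_eq:
  assumes "0 < k"
  shows "q_catalan q k n = (1 - q ^ k) * q_factorial q (2 * n + k - 1)
           / (q_factorial q n * q_factorial q (n + k))"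
proof -
  have "q_factorial q (2 * n + k) = q_factorial q (2 * n + k - 1) * (1 - q ^ (2 * n + k))"
    using assms q_factorial_Suc[of q "2 * n + k - 1"] by simp
  moreover have "1 - q ^ (2 * n + k) \<noteq> 0" "1 - q \<noteq> 0"
    using assms one_minus_q_power_nonzero[of "2 * n + k"] one_minus_q_power_nonzero[of 1]
    by auto
  moreover have "2 * n + k - n = n + k" by simp
  ultimately show ?thesis
    by (simp add: q_catalan_def q_number_def q_binomial_def)
qed

lemma q_catalan_0: "0 < k \<Longrightarrow> q_catalan q k 0 = 1"
  using q_factorial_nonzero q_factorial_Suc[of q "k - 1"] one_minus_q_power_nonzero[of k]
  by (simp add: q_catalan_eq mult.commute)

lemma q_binomial_times_q_catalan:
  assumes "0 < k" "j \<le> Suc i"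
  shows "(- 1) ^ j * q powi binom2 (int i - int j + 1) * q_binomial q (i + j + k) (int i - int j + 1)
           * q_catalan q k j
       = (1 - q ^ k) * catalan_term i k j"
proof -
  have 1: "int i - int j + 1 = int (Suc i - j)" using assms by simp
  have 2: "binom2 (int m) = int (m choose 2)" for m
    by (cases m) (simp_all add: binom2_def choose_two zdiv_int algebra_simps)
  have 3: "i + j + k - (Suc i - j) = 2 * j + k - 1" using assms by simp
  have "Suc i - j \<le> i + j + k" using assms by simp
  then show ?thesis
    unfolding 1 2 using assms(1) q_factorial_nonzero
    by (simp add: q_binomial_def q_catalan_eq catalan_term_def 3 mult_ac del: of_nat_diff)
qed

lemma q_binomial_q_catalan_sum:
  assumes "0 < k"
  shows "(\<Sum>j\<le>Suc i. q powi binom2 (int i - int j + 1)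
           * q_binomial q (i + j + k) (int i - int j + 1) * ((- 1) ^ j * q_catalan q k j)) = 0"
proof -
  have "(\<Sum>j\<le>Suc i. q powi binom2 (int i - int j + 1)
           * q_binomial q (i + j + k) (int i - int j + 1) * ((- 1) ^ j * q_catalan q k j))
      = (\<Sum>j\<le>Suc i. (1 - q ^ k) * catalan_term i k j)"
  proof (rule sum.cong)
    fix j assume "j \<in> {..Suc i}"
    then show "q powi binom2 (int i - int j + 1)
           * q_binomial q (i + j + k) (int i - int j + 1) * ((- 1) ^ j * q_catalan q k j)
         = (1 - q ^ k) * catalan_term i k j"
      using q_binomial_times_q_catalan[OF assms, of j i] by (simp add: mult_ac)
  qed simp
  also have "\<dots> = (1 - q ^ k) * (\<Sum>j\<le>Suc i. catalan_term i k j)"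
    by (rule sum_distrib_left[symmetric])
  finally show ?thesis by (simp only: catalan_term_sum mult_zero_right)
qed

section \<open>The two determinants\<close>

lemma q_binomial_0: "q_binomial q a 0 = 1"
  using q_factorial_nonzero by (simp add: q_binomial_def)

lemma det_eq_q_catalan:
  assumes "0 < k"
  shows "det (mat n n (\<lambda>(i, j). q powi binom2 (int i - int j + 1)
           * q_binomial q (i + j + k) (int i - int j + 1))) = q_catalan q k n"
proof -
  have "det (mat n n (\<lambda>(i, j). q powi binom2 (int i - int j + 1)
           * q_binomial q (i + j + k) (int i - int j + 1)))
      = (\<Prod>i<n. - (q powi binom2 (int i - int (Suc i) + 1)
           * q_binomial q (i + Suc i + k) (int i - int (Suc i) + 1)))
        * ((- 1) ^ n * q_catalan q k n)"
    \<comment> \<open>Beyond the superdiagonal the lower index is negative, where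
      \<open>q_binomial\<close> is 0 by convention.\<close>
    by (rule det_hessenberg)
      (use q_binomial_q_catalan_sum[OF assms] in
        \<open>simp_all add: q_binomial_def[of _ _ "int _ - int _ + 1"] q_catalan_0 assms\<close>)
  \<comment> \<open>On the superdiagonal the exponent and the lower index are both 0, so its entries
    are 1 and only signs remain to cancel.\<close>
  also have "\<dots> = q_catalan q k n"
    by (simp add: q_binomial_0 binom2_def flip: power_mult_distrib)
  finally show ?thesis .
qed

text \<open>The entries differ from those of the other matrix by the factor
  \<open>q powi (int j - int i)\<close>. Rescaling the kernel sequence by \<open>(1 / q) ^ j\<close>
  absorbs the column part; the row part is a common factor of each relation.\<close>

lemma det_shifted_eq_q_catalan:
  assumes "0 < k" "q \<noteq> 0"
  shows "det (mat n n (\<lambda>(i, j). q powi binom2 (int i - int j)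
           * q_binomial q (i + j + k) (int i - int j + 1))) = q_catalan q k n"
proof -
  have scale: "q powi binom2 (int i - int j) * ((- 1 / q) ^ j * x)
      = q powi (- int i) * (q powi binom2 (int i - int j + 1) * ((- 1) ^ j * x))" for i j x
  proof -
    have "binom2 (a + 1) = binom2 a + a" for a
    proof -
      have "(a + 1) * (a + 1 - 1) = a * (a - 1) + a * 2" by (simp add: algebra_simps)
      then show ?thesis unfolding binom2_def by simp
    qed
    then have "binom2 (int i - int j) = - int i + binom2 (int i - int j + 1) + int j" by simp
    then have "q powi binom2 (int i - int j)
        = q powi (- int i) * q powi binom2 (int i - int j + 1) * q ^ j"
      using assms(2) by (simp only: power_int_add power_int_of_nat simp_thms)
    then have "q powi binom2 (int i - int j) * ((- 1 / q) ^ j * x)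
        = q powi (- int i) * (q powi binom2 (int i - int j + 1) * (q ^ j * (- 1 / q) ^ j * x))"
      by (simp only: mult.assoc)
    moreover have "q ^ j * (- 1 / q) ^ j = (- 1) ^ j"
      using assms(2) by (simp flip: power_mult_distrib)
    ultimately show ?thesis by (simp only:)
  qed
  have ker: "(\<Sum>j\<le>Suc i. q powi binom2 (int i - int j)
        * q_binomial q (i + j + k) (int i - int j + 1) * ((- 1 / q) ^ j * q_catalan q k j)) = 0" for i
  proof -
    have "(\<Sum>j\<le>Suc i. q powi binom2 (int i - int j)
        * q_binomial q (i + j + k) (int i - int j + 1) * ((- 1 / q) ^ j * q_catalan q k j))
      = (\<Sum>j\<le>Suc i. q powi (- int i) * (q powi binom2 (int i - int j + 1)
        * q_binomial q (i + j + k) (int i - int j + 1) * ((- 1) ^ j * q_catalan q k j)))"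
    proof (rule sum.cong)
      fix j
      show "q powi binom2 (int i - int j)
          * q_binomial q (i + j + k) (int i - int j + 1) * ((- 1 / q) ^ j * q_catalan q k j)
        = q powi (- int i) * (q powi binom2 (int i - int j + 1)
          * q_binomial q (i + j + k) (int i - int j + 1) * ((- 1) ^ j * q_catalan q k j))"
        using scale[of i j "q_binomial q (i + j + k) (int i - int j + 1) * q_catalan q k j"]
        by (simp only: mult_ac)
    qed simp
    then show ?thesis
      by (simp only: q_binomial_q_catalan_sum[OF assms(1)] mult_zero_right flip: sum_distrib_left)
  qed
  have "det (mat n n (\<lambda>(i, j). q powi binom2 (int i - int j)
           * q_binomial q (i + j + k) (int i - int j + 1)))
      = (\<Prod>i<n. - (q powi binom2 (int i - int (Suc i))
           * q_binomial q (i + Suc i + k) (int i - int (Suc i) + 1)))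
        * ((- 1 / q) ^ n * q_catalan q k n)"
    by (rule det_hessenberg)
      (use ker in \<open>simp_all add: q_binomial_def[of _ _ "int _ - int _ + 1"] q_catalan_0 assms\<close>)
  \<comment> \<open>Here the superdiagonal entries are \<open>q\<close>, because
    \<open>binom2 (- 1) = 1\<close>.\<close>
  also have "\<dots> = (- q) ^ n * (- 1 / q) ^ n * q_catalan q k n"
    by (simp add: q_binomial_0 binom2_def)
  also have "\<dots> = q_catalan q k n"
    using assms(2) by (simp flip: power_mult_distrib)
  finally show ?thesis .
qed

end

section \<open>Powers of the indeterminate and the final specialisation\<close>

lemma indet_power: "indet ^ m = to_fract (monom 1 m)"
proof (induction m)
  case 0
  then show ?case by simp
next
  case (Suc m)
  then show ?case by (simp add: indet_def monom_Suc flip: to_fract_mult)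
qed

text \<open>Comparing degrees of polynomials shows that the indeterminate is not a root of unity, as
  the general results require.\<close>

lemma indet_power_neq_1:
  assumes "0 < m"
  shows "indet ^ m \<noteq> 1"
proof
  assume "indet ^ m = 1"
  then have "to_fract (monom (1::rat) m) = to_fract 1" by (simp add: indet_power)
  then have "monom (1::rat) m = 1" by (simp only: to_fract_eq_iff)
  then have "degree (monom (1::rat) m) = 0" by simp
  then show False using assms by (simp add: degree_monom_eq)
qed

lemma indet_nonzero: "indet \<noteq> 0"
  by (simp add: indet_def)

theorem theorem7:
  fixes k n :: nat and q :: "rat poly fract"
  assumes "k \<ge> 1"
  defines "q \<equiv> indet"
  shows "det (mat n n (\<lambda>(i, j). q powi binom2 (int i - int j)
              * q_binomial q (i + j + k) (int i - int j + 1)))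
         = det (mat n n (\<lambda>(i, j). q powi binom2 (int i - int j + 1)
              * q_binomial q (i + j + k) (int i - int j + 1)))
       \<and> det (mat n n (\<lambda>(i, j). q powi binom2 (int i - int j + 1)
              * q_binomial q (i + j + k) (int i - int j + 1)))
         = q_catalan q k n
       \<and> q_catalan q k n
         = q_number q k / q_number q (2 * n + k) * q_binomial q (2 * n + k) (int n)"
proof -
  have k: "0 < k" using assms(1) by simp
  show ?thesis
    \<comment> \<open>Both determinants equal the q-Catalan number; the last conjunct is its
      definition.\<close>
    using det_eq_q_catalan[of indet k n, OF indet_power_neq_1 k]
      det_shifted_eq_q_catalan[of indet k n, OF indet_power_neq_1 k indet_nonzero]
    by (simp only: q_def q_catalan_def simp_thms)
qed

end
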